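(* Let $G=\mathrm{Sz}(2^{2n+1})$ be the Suzuki group with $n\geq 1$, and let $\mathcal{C}$ be a conjugacy class of elements of order four in $G$. Then $K_{\mathcal{C}}$ is irreducible.
   Context: For a finite group $G$ and a subset $\mathcal{C}\subseteq G\setminus\{1\}$ closed under conjugation, the Killing form $K_{\mathcal{C}}$ is the bilinear form on the complex vector space with basis $\mathcal{C}$ given on basis elements by $K_{\mathcal{C}}(a,b)=|C_G(ab)\cap\mathcal{C}|$. $K_{\mathcal{C}}$ is irreducible if the graph with vertex set $\mathcal{C}$, in which distinct $a,b$ are adjacent iff $C_G(ab)\cap\mathcal{C}\neq\emptyset$, is connected, and reducible otherwise. *)

theory Defs
  imports "Jordan_Normal_Form.Matrix" "HOL-Algebra.Multiplicative_Group"
begin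

section \<open>Generic group-theoretic notions (HOL-Algebra groups)\<close>

definition centralizer_set :: "('g, 'b) monoid_scheme \<Rightarrow> 'g \<Rightarrow> 'g set" where
  "centralizer_set G x = {g \<in> carrier G. g \<otimes>\<^bsub>G\<^esub> x = x \<otimes>\<^bsub>G\<^esub> g}"

definition conj_class :: "('g, 'b) monoid_scheme \<Rightarrow> 'g \<Rightarrow> 'g set" where
  "conj_class G x = {g \<otimes>\<^bsub>G\<^esub> x \<otimes>\<^bsub>G\<^esub> inv\<^bsub>G\<^esub> g | g. g \<in> carrier G}"

text \<open>Killing form on the formal span of C: K_C(a,b) = |C_G(ab) \<inter> C| on basis elements.\<close>
definition killing_form_basis :: "('g, 'b) monoid_scheme \<Rightarrow> 'g set \<Rightarrow> 'g \<Rightarrow> 'g \<Rightarrow> nat" where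
  "killing_form_basis G C a b = card (centralizer_set G (a \<otimes>\<^bsub>G\<^esub> b) \<inter> C)"

text \<open>Adjacency in the graph on vertex set C: distinct a, b adjacent iff C_G(ab) \<inter> C is nonempty.\<close>
definition killing_adj :: "('g, 'b) monoid_scheme \<Rightarrow> 'g set \<Rightarrow> 'g \<Rightarrow> 'g \<Rightarrow> bool" where
  "killing_adj G C a b \<longleftrightarrow> a \<in> C \<and> b \<in> C \<and> a \<noteq> b \<and>
      centralizer_set G (a \<otimes>\<^bsub>G\<^esub> b) \<inter> C \<noteq> {}"

text \<open>K_C irreducible iff that graph is connected (any two vertices joined by a path).\<close>
definition killing_irreducible :: "('g, 'b) monoid_scheme \<Rightarrow> 'g set \<Rightarrow> bool" where
  "killing_irreducible G C \<longleftrightarrow>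
     (\<forall>a\<in>C. \<forall>b\<in>C. (a, b) \<in> {(x, y). killing_adj G C x y}\<^sup>*)"

section \<open>The Suzuki group Sz(2^(2n+1)) as a matrix group (Wilson, The Finite Simple Groups, 4.2)\<close>

text \<open>The field is any field with 2^(2n+1) elements; sigma is x \<mapsto> x^(2^(n+1)), whose square is the Frobenius.\<close>
definition sz_sigma :: "nat \<Rightarrow> 'a::field \<Rightarrow> 'a" where
  "sz_sigma n x = x ^ (2 ^ (n + 1))"

definition sz_T :: "nat \<Rightarrow> 'a::field \<Rightarrow> 'a \<Rightarrow> 'a mat" where
  "sz_T n a b = mat_of_rows_list 4
     [[1, 0, 0, 0],
      [a, 1, 0, 0],
      [b, sz_sigma n a, 1, 0],
      [a ^ 2 * sz_sigma n a + a * b + sz_sigma n b, a * sz_sigma n a + b, a, 1]]"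

definition sz_D :: "nat \<Rightarrow> 'a::field \<Rightarrow> 'a mat" where
  "sz_D n l = mat_of_rows_list 4
     [[l ^ (1 + 2 ^ n), 0, 0, 0],
      [0, l ^ (2 ^ n), 0, 0],
      [0, 0, inverse l ^ (2 ^ n), 0],
      [0, 0, 0, inverse l ^ (1 + 2 ^ n)]]"

definition sz_W :: "'a::field mat" where
  "sz_W = mat_of_rows_list 4 [[0, 0, 0, 1], [0, 0, 1, 0], [0, 1, 0, 0], [1, 0, 0, 0]]"

definition sz_gens :: "nat \<Rightarrow> 'a::field mat set" where
  "sz_gens n = {sz_T n a b | a b. True} \<union> {sz_D n l | l. l \<noteq> 0} \<union> {sz_W}"

text \<open>Submonoid generated by the generators; since everything is finite, this is the generated subgroup.\<close>
inductive_set sz_set :: "nat \<Rightarrow> 'a::field mat set" for n where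
  one: "1\<^sub>m 4 \<in> sz_set n"
| step: "g \<in> sz_gens n \<Longrightarrow> h \<in> sz_set n \<Longrightarrow> g * h \<in> sz_set n"

definition Suzuki :: "nat \<Rightarrow> 'a::field mat monoid" where
  "Suzuki n = \<lparr>carrier = sz_set n, mult = (*), one = 1\<^sub>m 4\<rparr>"

end

theory Submission
  imports Defs "HOL-Number_Theory.Residues"
begin

text \<open>
  Let \<open>x \<in> C\<close>. The elements \<open>g\<close> for which \<open>x\<close> and its conjugate by \<open>g\<close> lie in one component form a
  submonoid, so only the generators have to be tested. A 2-element acting on the \<open>q\<^sup>2 + 1\<close> cosets of
  the Borel subgroup \<open>B\<close> (the points of the ovoid) fixes one of them, so \<open>x\<close> is conjugate to some
  \<open>T 1 u\<close>. Inside the Sylow subgroup \<open>Q\<close> of all \<open>T a b\<close>, any two distinct members of \<open>C\<close> are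
  adjacent: their product is either central in \<open>Q\<close> or some \<open>T e d\<close> with \<open>e \<noteq> 0\<close>, which commutes with
  \<open>T e (e * \<sigma> e * u) \<in> C\<close>. This settles the generators in \<open>B\<close>. For \<open>W\<close>, choose \<open>y = T a b\<close> in \<open>C\<close> such
  that \<open>y * W\<close> has trace 0, which is possible because \<open>1 + u + \<sigma> u\<close> is nonzero, hence a square. Then
  \<open>y * W\<close> is a 2-element, so its square \<open>y * (W * y * W)\<close> lies in the centre of a Sylow
  2-subgroup, and hence commutes with a member of \<open>C\<close>.
\<close>

lemma odd_card_fixed_points_involution:
  assumes "finite S" "\<And>x. x \<in> S \<Longrightarrow> \<phi> x \<in> S" "\<And>x. x \<in> S \<Longrightarrow> \<phi> (\<phi> x) = x"
  shows "odd (card {x \<in> S. \<phi> x = x}) \<longleftrightarrow> odd (card S)"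
  using assms
proof (induction "card S" arbitrary: S rule: less_induct)
  case less
  show ?case
  proof (cases "\<exists>x\<in>S. \<phi> x \<noteq> x")
    case False
    then have "{x \<in> S. \<phi> x = x} = S" by blast
    then show ?thesis by simp
  next
    case True
    then obtain x where x: "x \<in> S" "\<phi> x \<noteq> x" by blast
    define S' where "S' = S - {x, \<phi> x}"
    have card: "card S = card S' + 2"
      using x less.prems card_Diff_subset[of "{x, \<phi> x}" S] card_mono[of S "{x, \<phi> x}"]
      by (simp add: S'_def)
    have "\<phi> y \<in> S'" if "y \<in> S'" for y
      using that less.prems x unfolding S'_def by (metis DiffE DiffI insert_iff singletonD)
    then have "odd (card {x \<in> S'. \<phi> x = x}) \<longleftrightarrow> odd (card S')"
      using less.prems card by (intro less.hyps) (auto simp: S'_def)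
    moreover have "{x \<in> S'. \<phi> x = x} = {x \<in> S. \<phi> x = x}"
      using less.prems x by (auto simp: S'_def)
    ultimately show ?thesis using card by simp
  qed
qed

lemma odd_card_imp_fixed_point:
  assumes "finite S" "odd (card S)" "\<And>x. x \<in> S \<Longrightarrow> \<phi> x \<in> S"
    and "\<And>x. x \<in> S \<Longrightarrow> (\<phi> ^^ (2 ^ k)) x = x"
  shows "\<exists>x\<in>S. \<phi> x = x"
  using assms
proof (induction k arbitrary: S)
  case 0
  then have "S \<noteq> {}" by auto
  with 0 show ?case by auto
next
  case (Suc k)
  let ?\<psi> = "\<phi> ^^ (2 ^ k)"
  define S' where "S' = {x \<in> S. ?\<psi> x = x}"
  have closed: "(\<phi> ^^ j) x \<in> S" if "x \<in> S" for x j
    using that Suc.prems(3) by (induction j) auto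
  have "?\<psi> (?\<psi> x) = x" if "x \<in> S" for x
    using Suc.prems(4)[OF that] by (simp add: mult_2 funpow_add)
  then have "odd (card S')"
    unfolding S'_def using Suc.prems closed odd_card_fixed_points_involution[of S ?\<psi>] by blast
  moreover have "\<phi> x \<in> S'" if "x \<in> S'" for x
    using that Suc.prems(3) unfolding S'_def by (auto simp: funpow_swap1[symmetric])
  ultimately have "\<exists>x\<in>S'. \<phi> x = x"
    using Suc.prems(1) by (intro Suc.IH) (auto simp: S'_def)
  then show ?case by (auto simp: S'_def)
qed

section \<open>Conjugation and the Killing graph\<close>

context group
begin

definition conjugate :: "'a \<Rightarrow> 'a \<Rightarrow> 'a" where
  "conjugate g x = g \<otimes> x \<otimes> inv g"

lemma conjugate_closed [simp, intro]:
  "g \<in> carrier G \<Longrightarrow> x \<in> carrier G \<Longrightarrow> conjugate g x \<in> carrier G"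
  by (simp add: conjugate_def)

lemma conjugate_mult:
  assumes "g \<in> carrier G" "x \<in> carrier G" "y \<in> carrier G"
  shows "conjugate g (x \<otimes> y) = conjugate g x \<otimes> conjugate g y"
  using assms by (simp add: conjugate_def m_assoc inv_solve_left)

lemma conjugate_conjugate:
  assumes "g \<in> carrier G" "h \<in> carrier G" "x \<in> carrier G"
  shows "conjugate g (conjugate h x) = conjugate (g \<otimes> h) x"
  using assms by (simp add: conjugate_def m_assoc inv_mult_group)

lemma conjugate_one [simp]: "x \<in> carrier G \<Longrightarrow> conjugate \<one> x = x"
  by (simp add: conjugate_def)

lemma conjugate_inv_conjugate [simp]:
  assumes "g \<in> carrier G" "x \<in> carrier G"
  shows "conjugate (inv g) (conjugate g x) = x"
  using assms by (simp add: conjugate_conjugate)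

lemma mult_conjugate_inv:
  assumes "g \<in> carrier G" "x \<in> carrier G"
  shows "g \<otimes> conjugate (inv g) x = x \<otimes> g"
  using assms by (simp add: conjugate_def flip: m_assoc)

lemma conjugate_inj:
  assumes "g \<in> carrier G" "x \<in> carrier G" "y \<in> carrier G"
  shows "conjugate g x = conjugate g y \<longleftrightarrow> x = y"
  using assms by (metis conjugate_inv_conjugate)

lemma conjugate_eqI:
  assumes "g \<otimes> x = y \<otimes> g" "g \<in> carrier G" "y \<in> carrier G"
  shows "conjugate g x = y"
  using assms by (simp add: conjugate_def m_assoc)

lemma conj_class_eq: "conj_class G x = (\<lambda>g. conjugate g x) ` carrier G"
  by (auto simp: conj_class_def conjugate_def)

lemma conj_class_subset: "x \<in> carrier G \<Longrightarrow> conj_class G x \<subseteq> carrier G"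
  by (auto simp: conj_class_eq)

lemma ord_conjugate:
  assumes "g \<in> carrier G" "x \<in> carrier G"
  shows "ord (conjugate g x) = ord x"
proof -
  have pow: "conjugate g x [^] k = conjugate g (x [^] k)" for k :: nat
    using assms by (induction k) (simp_all add: conjugate_mult, simp add: conjugate_def)
  have "conjugate g y = \<one> \<longleftrightarrow> y = \<one>" if "y \<in> carrier G" for y
    using conjugate_inj[of g y \<one>] that assms by (simp add: conjugate_def)
  then have "conjugate g x [^] k = \<one> \<longleftrightarrow> ord x dvd k" for k :: nat
    using assms pow by (simp add: pow_eq_id)
  then show ?thesis
    using assms by (simp add: ord_unique)
qed

lemma self_in_conj_class: "x \<in> carrier G \<Longrightarrow> x \<in> conj_class G x"
  unfolding conj_class_eq by (rule image_eqI[of _ _ \<one>]) simp_all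

lemma conjugate_in_conj_class:
  assumes "g \<in> carrier G" "x \<in> carrier G" "y \<in> conj_class G x"
  shows "conjugate g y \<in> conj_class G x"
  using assms by (auto simp: conj_class_eq conjugate_conjugate)

lemma conj_class_conjugate:
  assumes "g \<in> carrier G" "x \<in> carrier G"
  shows "conj_class G (conjugate g x) = conj_class G x"
proof
  show "conj_class G (conjugate g x) \<subseteq> conj_class G x"
    using assms by (auto simp: conj_class_eq conjugate_conjugate)
  have "conjugate h x \<in> conj_class G (conjugate g x)" if "h \<in> carrier G" for h
    unfolding conj_class_eq
    using assms that by (intro image_eqI[of _ _ "h \<otimes> inv g"]) (simp_all add: conjugate_conjugate m_assoc)
  then show "conj_class G x \<subseteq> conj_class G (conjugate g x)"
    by (auto simp: conj_class_eq[of x])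
qed

lemma killing_adjI:
  assumes "a \<in> C" "b \<in> C" "a \<noteq> b" "c \<in> C" "c \<in> carrier G"
    and "c \<otimes> (a \<otimes> b) = (a \<otimes> b) \<otimes> c"
  shows "killing_adj G C a b"
  using assms by (auto simp: killing_adj_def centralizer_set_def)

abbreviation linked :: "'a \<Rightarrow> 'a \<Rightarrow> 'a \<Rightarrow> bool" where
  "linked x a b \<equiv> (a, b) \<in> {(a, b). killing_adj G (conj_class G x) a b}\<^sup>*"

lemma killing_adj_conjugate:
  assumes "g \<in> carrier G" "x \<in> carrier G" "killing_adj G (conj_class G x) a b"
  shows "killing_adj G (conj_class G x) (conjugate g a) (conjugate g b)"
proof -
  obtain c where c: "c \<in> carrier G" "c \<otimes> (a \<otimes> b) = (a \<otimes> b) \<otimes> c" "c \<in> conj_class G x"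
    using assms(3) by (auto simp: killing_adj_def centralizer_set_def)
  have ab: "a \<in> conj_class G x" "b \<in> conj_class G x" "a \<noteq> b"
    using assms(3) by (auto simp: killing_adj_def)
  then have [simp]: "a \<in> carrier G" "b \<in> carrier G"
    using conj_class_subset assms(2) by auto
  show ?thesis
  proof (rule killing_adjI[where c = "conjugate g c"])
    show "conjugate g c \<otimes> (conjugate g a \<otimes> conjugate g b) =
        conjugate g a \<otimes> conjugate g b \<otimes> conjugate g c"
      using assms(1) c by (simp flip: conjugate_mult)
  qed (use assms(1,2) ab c in \<open>auto simp: conjugate_inj intro: conjugate_in_conj_class\<close>)
qed

lemma linked_conjugate:
  assumes "g \<in> carrier G" "x \<in> carrier G" "linked x a b"
  shows "linked x (conjugate g a) (conjugate g b)"
  using assms(3)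
proof induction
  case (step b c)
  then show ?case
    using killing_adj_conjugate[OF assms(1,2)] by (auto intro: rtrancl_into_rtrancl)
qed simp

lemma linked_mult:
  assumes "g \<in> carrier G" "h \<in> carrier G" "x \<in> carrier G"
    and "linked x x (conjugate g x)" "linked x x (conjugate h x)"
  shows "linked x x (conjugate (g \<otimes> h) x)"
proof -
  have "linked x (conjugate g x) (conjugate g (conjugate h x))"
    by (rule linked_conjugate) (use assms in auto)
  with assms show ?thesis
    by (simp add: conjugate_conjugate)
qed

lemma killing_irreducibleI:
  assumes "x \<in> carrier G" "\<And>g. g \<in> carrier G \<Longrightarrow> linked x x (conjugate g x)"
  shows "killing_irreducible G (conj_class G x)"
proof -
  have "linked x (conjugate g x) (conjugate h x)" if "g \<in> carrier G" "h \<in> carrier G" for g h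
  proof -
    have "linked x (conjugate g x) (conjugate g (conjugate (inv g \<otimes> h) x))"
      using that assms by (intro linked_conjugate) auto
    then show ?thesis
      using that assms(1) by (simp add: conjugate_conjugate flip: m_assoc)
  qed
  then show ?thesis
    by (auto simp: killing_irreducible_def conj_class_eq)
qed

lemma two_element_conjugate_in_odd_index_subgroup:
  assumes "subgroup H G" "finite (rcosets H)" "odd (card (rcosets H))"
    and "x \<in> carrier G" "x [^] (2 ^ k :: nat) = \<one>"
  shows "\<exists>g\<in>carrier G. conjugate g x \<in> H"
proof -
  have H: "H \<subseteq> carrier G" using assms(1) by (rule subgroup.subset)
  have pow: "((\<lambda>K. K #> x) ^^ j) (H #> g) = H #> (g \<otimes> x [^] j)" if "g \<in> carrier G" for g j
    using that H assms(4) by (induction j) (simp_all add: coset_mult_assoc m_assoc)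
  have "\<exists>K\<in>rcosets H. K #> x = K"
  proof (rule odd_card_imp_fixed_point[where k = k])
    fix K assume "K \<in> rcosets H"
    then obtain g where g: "g \<in> carrier G" "K = H #> g" by (auto simp: RCOSETS_def)
    show "K #> x \<in> rcosets H"
      using g H assms(4) by (auto simp: coset_mult_assoc intro: rcosetsI)
    show "((\<lambda>K. K #> x) ^^ 2 ^ k) K = K"
      using g assms(5) by (simp add: pow)
  qed (use assms in auto)
  then obtain g where g: "g \<in> carrier G" "H #> (g \<otimes> x) = H #> g"
    using H assms(4) by (auto simp: RCOSETS_def coset_mult_assoc)
  then have "g \<otimes> x \<in> H #> g"
    using rcos_self[OF _ assms(1), of "g \<otimes> x"] assms(4) by auto
  then obtain h where "h \<in> H" "g \<otimes> x = h \<otimes> g"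
    by (auto simp: r_coset_def)
  then show ?thesis
    using conjugate_eqI[of g x h] g H by auto
qed

end

section \<open>The field and the generating matrices\<close>

lemma mat4_mult:
  fixes a11 :: "'a::comm_semiring_0"
  shows "mat_of_rows_list 4 [[a11,a12,a13,a14],[a21,a22,a23,a24],[a31,a32,a33,a34],[a41,a42,a43,a44]] *
    mat_of_rows_list 4 [[b11,b12,b13,b14],[b21,b22,b23,b24],[b31,b32,b33,b34],[b41,b42,b43,b44]] =
    mat_of_rows_list 4
     [[a11*b11+a12*b21+a13*b31+a14*b41, a11*b12+a12*b22+a13*b32+a14*b42,
       a11*b13+a12*b23+a13*b33+a14*b43, a11*b14+a12*b24+a13*b34+a14*b44],
      [a21*b11+a22*b21+a23*b31+a24*b41, a21*b12+a22*b22+a23*b32+a24*b42,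
       a21*b13+a22*b23+a23*b33+a24*b43, a21*b14+a22*b24+a23*b34+a24*b44],
      [a31*b11+a32*b21+a33*b31+a34*b41, a31*b12+a32*b22+a33*b32+a34*b42,
       a31*b13+a32*b23+a33*b33+a34*b43, a31*b14+a32*b24+a33*b34+a34*b44],
      [a41*b11+a42*b21+a43*b31+a44*b41, a41*b12+a42*b22+a43*b32+a44*b42,
       a41*b13+a42*b23+a43*b33+a44*b43, a41*b14+a42*b24+a43*b34+a44*b44]]"
  by (rule eq_matI)
    (auto simp: mat_of_rows_list_def scalar_prod_def less_Suc_eq numeral_eq_Suc
      sum.atLeast0_lessThan_Suc add_ac)

lemma one_mat4:
  "1\<^sub>m 4 = (mat_of_rows_list 4 [[1,0,0,0],[0,1,0,0],[0,0,1,0],[0,0,0,1]] :: 'a::field mat)"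
  by (rule eq_matI) (auto simp: mat_of_rows_list_def less_Suc_eq numeral_eq_Suc)

locale suzuki_field =
  fixes n :: nat and F :: "'a::{field,finite} itself"
  assumes card_field: "card (UNIV :: 'a set) = 2 ^ (2 * n + 1)"
begin

abbreviation \<sigma> :: "'a \<Rightarrow> 'a" where "\<sigma> \<equiv> sz_sigma n"

lemma CHAR_eq_2: "CHAR('a) = 2"
proof -
  have "prime CHAR('a)"
    by (rule prime_CHAR_semidom) (rule finite_imp_CHAR_pos, simp)
  moreover have "CHAR('a) dvd 2 ^ (2 * n + 1)"
    using CHAR_dvd_CARD[where 'a='a] card_field by simp
  ultimately show ?thesis
    by (metis prime_dvd_power primes_dvd_imp_eq two_is_prime_nat)
qed

lemma two_eq_0 [simp]: "(2::'a) = 0"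
  using of_nat_CHAR[where 'a='a] by (simp add: CHAR_eq_2)

lemma add_self [simp]: "x + x = (0::'a)"
  using two_eq_0 by (metis mult_2 mult_zero_left)

lemma add_self_left [simp]: "x + (x + y) = (y::'a)"
  by (simp flip: add.assoc)

lemma uminus_eq [simp]: "- x = (x::'a)"
  by (simp add: minus_unique)

lemma add_eq_0: "x + y = 0 \<longleftrightarrow> x = (y::'a)"
  by (metis add_self add_self_left add_0_right)

lemma power_2n_add: "(x + y) ^ (2 ^ k) = x ^ (2 ^ k) + (y::'a) ^ (2 ^ k)"
  using freshmans_dream'[where 'a='a, of "2 ^ k" k x y] by (simp add: CHAR_eq_2)

lemma square_add: "(x + y)\<^sup>2 = x\<^sup>2 + (y::'a)\<^sup>2"
  using power_2n_add[of x y 1] by simp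

lemma square_eq_iff: "x\<^sup>2 = y\<^sup>2 \<longleftrightarrow> x = (y::'a)"
  by (metis add_eq_0 square_add zero_eq_power2)

lemma power_card_field: "x ^ card (UNIV :: 'a set) = x" for x :: 'a
proof (cases "x = 0")
  case False
  have "(\<Prod>y\<in>UNIV - {0}. y) = (\<Prod>y\<in>UNIV - {0}. x * y)"
    by (rule prod.reindex_bij_witness[of _ "\<lambda>y. x * y" "\<lambda>y. y / x"]) (use False in auto)
  also have "\<dots> = x ^ (card (UNIV :: 'a set) - 1) * (\<Prod>y\<in>UNIV - {0}. y)"
    by (simp add: prod.distrib)
  finally have "x ^ (card (UNIV :: 'a set) - 1) = 1"
    by simp
  then have "x * x ^ (card (UNIV :: 'a set) - 1) = x"
    by simp
  then show ?thesis
    by (subst (asm) power_Suc[symmetric]) (simp add: card_gt_0_iff)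
qed (simp add: card_field)

lemma square_root: "\<exists>a::'a. a\<^sup>2 = v"
proof
  have "(v ^ 2 ^ (2 * n))\<^sup>2 = v ^ card (UNIV :: 'a set)"
    by (simp add: card_field mult.commute flip: power_mult)
  also have "\<dots> = v" by (rule power_card_field)
  finally show "(v ^ 2 ^ (2 * n))\<^sup>2 = v" .
qed

lemma sigma_add [simp]: "\<sigma> (x + y) = \<sigma> x + \<sigma> y"
  unfolding sz_sigma_def by (rule power_2n_add)

lemma sigma_mult [simp]: "\<sigma> (x * y) = \<sigma> x * \<sigma> y"
  by (simp add: sz_sigma_def power_mult_distrib)

lemma sigma_divide [simp]: "\<sigma> (x / y) = \<sigma> x / \<sigma> y"
  by (simp add: sz_sigma_def power_divide)

lemma sigma_power [simp]: "\<sigma> (x ^ k) = \<sigma> x ^ k"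
  by (simp add: sz_sigma_def mult.commute flip: power_mult)

lemma sigma_0 [simp]: "\<sigma> 0 = 0" and sigma_1 [simp]: "\<sigma> 1 = 1"
  by (simp_all add: sz_sigma_def)

lemma sigma_eq_0_iff [simp]: "\<sigma> x = 0 \<longleftrightarrow> x = 0"
  by (simp add: sz_sigma_def)

lemma sigma_sigma [simp]: "\<sigma> (\<sigma> x) = x\<^sup>2"
proof -
  have "(2::nat) ^ (n + 1) * 2 ^ (n + 1) = card (UNIV :: 'a set) * 2"
    by (simp add: card_field power_even_eq power2_eq_square)
  then show ?thesis
    by (simp only: sz_sigma_def flip: power_mult) (simp only: power_mult power_card_field)
qed

lemma half_sigma_square: "(l ^ 2 ^ n)\<^sup>2 = \<sigma> l" for l :: 'a
  by (simp add: sz_sigma_def mult.commute flip: power_mult)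

lemma sigma_neq_add_1: "u + \<sigma> u \<noteq> 1"
proof
  assume u: "u + \<sigma> u = 1"
  then have "\<sigma> (u + \<sigma> u) = u + \<sigma> u" by simp
  then have "\<sigma> u + u\<^sup>2 = u + \<sigma> u" by simp
  then have "u\<^sup>2 = u"
    by (metis add.commute add_self_left)
  then have "u = 0 \<or> u = 1" by (simp add: power2_eq_square)
  then show False using u by auto
qed

definition f :: "'a \<Rightarrow> 'a \<Rightarrow> 'a" where
  "f a b = a\<^sup>2 * \<sigma> a + a * b + \<sigma> b"

lemma f_scaled: "f a (a * \<sigma> a * u) = a\<^sup>2 * \<sigma> a * (1 + u + \<sigma> u)"
  by (simp add: f_def algebra_simps power2_eq_square)

lemma f_eq_0_iff [simp]: "f a b = 0 \<longleftrightarrow> a = 0 \<and> b = 0"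
proof (cases "a = 0")
  case True
  then show ?thesis by (simp add: f_def)
next
  case False
  then have "f a b = a\<^sup>2 * \<sigma> a * (1 + b / (a * \<sigma> a) + \<sigma> (b / (a * \<sigma> a)))"
    using f_scaled[of a "b / (a * \<sigma> a)"] by simp
  moreover have "1 + b / (a * \<sigma> a) + \<sigma> (b / (a * \<sigma> a)) \<noteq> 0"
    by (metis sigma_neq_add_1 add_eq_0 add.assoc)
  ultimately show ?thesis using False by simp
qed

lemma sigma_f: "\<sigma> (f a b) = (\<sigma> a)\<^sup>2 * a\<^sup>2 + \<sigma> a * \<sigma> b + b\<^sup>2"
  by (simp add: f_def)

abbreviation T :: "'a \<Rightarrow> 'a \<Rightarrow> 'a mat" where "T \<equiv> sz_T n"
abbreviation D :: "'a \<Rightarrow> 'a mat" where "D \<equiv> sz_D n"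
abbreviation W :: "'a mat" where "W \<equiv> sz_W"

lemma T_eq: "T a b = mat_of_rows_list 4
     [[1, 0, 0, 0], [a, 1, 0, 0], [b, \<sigma> a, 1, 0], [f a b, a * \<sigma> a + b, a, 1]]"
  by (simp add: sz_T_def f_def)

lemma D_eq: "D l = mat_of_rows_list 4
     [[l * l ^ 2 ^ n, 0, 0, 0], [0, l ^ 2 ^ n, 0, 0],
      [0, 0, 1 / l ^ 2 ^ n, 0], [0, 0, 0, 1 / (l * l ^ 2 ^ n)]]"
  by (simp add: sz_D_def power_add power_inverse divide_simps)

lemmas mat_simps = T_eq sz_W_def mat4_mult one_mat4

lemma f_mult: "f (a + c) (b + d + \<sigma> a * c) = f a b + (a * \<sigma> a + b) * c + a * d + f c d"
  by (simp add: f_def algebra_simps power2_eq_square)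

lemma T_mult: "T a b * T c d = T (a + c) (b + d + \<sigma> a * c)"
  by (simp add: mat_simps f_mult) (simp add: algebra_simps)

lemma T_0_0: "T 0 0 = 1\<^sub>m 4"
  by (simp add: mat_simps f_def)

lemma D_mult: "D l * D m = D (l * m)"
  by (simp add: mat_simps D_eq power_mult_distrib mult_ac)

lemma D_1: "D 1 = 1\<^sub>m 4"
  by (simp add: mat_simps D_eq)

lemma W_mult_W: "W * W = 1\<^sub>m 4"
  by (simp add: mat_simps)

lemma W_D: "W * D l = D (1 / l) * W"
  by (simp add: mat_simps D_eq power_one_over)

lemma f_smult: "f (a * l) (b * (l * \<sigma> l)) = l\<^sup>2 * \<sigma> l * f a b"
  by (simp add: f_def algebra_simps power2_eq_square)

lemma T_D:
  assumes "l \<noteq> 0"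
  shows "T a b * D l = D l * T (a * l) (b * (l * \<sigma> l))"
proof -
  define m where "m = l ^ 2 ^ n"
  have "m \<noteq> 0" and "\<sigma> l = m\<^sup>2"
    using assms by (simp_all add: m_def half_sigma_square)
  then show ?thesis
    using assms f_smult[of a l b]
    by (simp add: mat_simps D_eq flip: m_def) (rule arg_cong[where f = "mat_of_rows_list 4"],
      simp add: field_simps power2_eq_square)
qed

lemma bruhat_step:
  fixes a b
  assumes "(a, b) \<noteq> (0, 0)"
  defines "p \<equiv> f a b" and "c \<equiv> a * \<sigma> a + b"
  shows "W * T a b * W * T (c / p) (a / p) = T (b / p) (a / p) * D (p\<^sup>2 / \<sigma> p) * W"
proof -
  define A B P C where "A = \<sigma> a" and "B = \<sigma> b" and "P = \<sigma> p" and "C = \<sigma> c"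
  have p: "p = a\<^sup>2 * A + a * b + B" and P: "P = A\<^sup>2 * a\<^sup>2 + A * B + b\<^sup>2"
    and C: "C = A * a\<^sup>2 + B" and c: "c = a * A + b"
    by (simp_all add: p_def P_def sigma_f A_def B_def C_def c_def) (simp add: f_def)
  have "p \<noteq> 0" "P \<noteq> 0" using assms(1) by (auto simp: p_def P_def)
  have half: "(p\<^sup>2 / P) ^ 2 ^ n = P / p"
  proof -
    have "((p\<^sup>2 / P) ^ 2 ^ n)\<^sup>2 = (P / p)\<^sup>2"
      unfolding half_sigma_square by (simp add: P_def power_divide)
    then show ?thesis by (simp only: square_eq_iff)
  qed
  note char2 = algebra_simps power2_eq_square
  have e1: "a * P + c * C = b * p"
    by (simp add: p P C c char2)
  have e2: "b * B + a * P = c * p"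
    by (simp add: p P C c char2)
  have e4: "A * p + b * c = P"
    by (simp add: p P C c char2)
  have "c\<^sup>2 * C + c * a * P + A * p\<^sup>2 = c * (a * P + c * C) + A * p\<^sup>2"
    by (simp add: algebra_simps power2_eq_square)
  also have "\<dots> = p * (A * p + b * c)"
    unfolding e1 by (simp add: algebra_simps power2_eq_square)
  also have "\<dots> = p * P"
    unfolding e4 ..
  finally have "c\<^sup>2 * C + c * a * P + A * p\<^sup>2 = p * P" .
  moreover have "f (c / p) (a / p) = (c\<^sup>2 * C + c * a * P + A * p\<^sup>2) / (p\<^sup>2 * P)"
    using \<open>p \<noteq> 0\<close> \<open>P \<noteq> 0\<close>
    by (simp add: f_def field_simps power2_eq_square flip: A_def B_def P_def C_def)
  ultimately have fq: "f (c / p) (a / p) = 1 / p"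
    using \<open>p \<noteq> 0\<close> \<open>P \<noteq> 0\<close> by (simp add: power2_eq_square)
  have "b\<^sup>2 * B + a * b * P + A * p\<^sup>2 = b * (b * B + a * P) + A * p\<^sup>2"
    by (simp add: algebra_simps power2_eq_square)
  also have "\<dots> = p * (A * p + b * c)"
    unfolding e2 by (simp add: algebra_simps power2_eq_square)
  also have "\<dots> = p * P"
    unfolding e4 ..
  finally have "b\<^sup>2 * B + a * b * P + A * p\<^sup>2 = p * P" .
  moreover have "f (b / p) (a / p) = (b\<^sup>2 * B + a * b * P + A * p\<^sup>2) / (p\<^sup>2 * P)"
    using \<open>p \<noteq> 0\<close> \<open>P \<noteq> 0\<close>
    by (simp add: f_def field_simps power2_eq_square flip: A_def B_def P_def C_def)
  ultimately have fr: "f (b / p) (a / p) = 1 / p"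
    using \<open>p \<noteq> 0\<close> \<open>P \<noteq> 0\<close> by (simp add: power2_eq_square)
  have Tq: "T (c / p) (a / p) = mat_of_rows_list 4
     [[1, 0, 0, 0], [c / p, 1, 0, 0], [a / p, C / P, 1, 0], [1 / p, b / P, c / p, 1]]"
    using e1 \<open>p \<noteq> 0\<close> \<open>P \<noteq> 0\<close>
    by (simp add: T_eq fq flip: C_def P_def) (simp add: field_simps)
  have Tr: "T (b / p) (a / p) = mat_of_rows_list 4
     [[1, 0, 0, 0], [b / p, 1, 0, 0], [a / p, B / P, 1, 0], [1 / p, c / P, b / p, 1]]"
    using e2 \<open>p \<noteq> 0\<close> \<open>P \<noteq> 0\<close>
    by (simp add: T_eq fr flip: B_def P_def) (simp add: field_simps)
  have Dm: "D (p\<^sup>2 / P) = mat_of_rows_list 4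
     [[p, 0, 0, 0], [0, P / p, 0, 0], [0, 0, p / P, 0], [0, 0, 0, 1 / p]]"
    unfolding D_eq half using \<open>p \<noteq> 0\<close> \<open>P \<noteq> 0\<close> by (simp add: power2_eq_square)
  have Ta: "T a b = mat_of_rows_list 4
     [[1, 0, 0, 0], [a, 1, 0, 0], [b, A, 1, 0], [p, c, a, 1]]"
    by (simp add: T_eq A_def p_def c_def)
  show ?thesis
    unfolding P_def[symmetric] Ta Tq Tr Dm sz_W_def mat4_mult
    using \<open>p \<noteq> 0\<close> \<open>P \<noteq> 0\<close>
    by (intro arg_cong[where f = "mat_of_rows_list 4"])
      (simp add: field_simps, simp add: p P C c char2)
qed


text \<open>
  The trace of \<open>T a b * W\<close> is \<open>f a b + \<sigma> a\<close>. If it vanishes, then \<open>T a b * W\<close> fixes the first row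
  \<open>(1, s + a, s, 1)\<close> of \<open>W * T s t\<close>, from which \<open>s\<close> and \<open>t\<close> are computed.
\<close>

lemma W_fixed_line:
  fixes a b
  assumes f: "f a b = \<sigma> a" and "a \<noteq> 0"
  defines "s \<equiv> (a + a * \<sigma> a + b) / \<sigma> a"
  defines "t \<equiv> s + a + s * \<sigma> s"
  shows "W * T s t * (T a b * W) = T t (s + a) * (W * T s t)"
proof -
  define A B S R where "A = \<sigma> a" and "B = \<sigma> b" and "S = \<sigma> s" and "R = \<sigma> t"
  have "A \<noteq> 0" using \<open>a \<noteq> 0\<close> by (simp add: A_def)
  have fA: "f a b = A" by (simp add: f A_def)
  have B: "B = A + a\<^sup>2 * A + a * b"
  proof -
    have "(a\<^sup>2 * A + a * b) + B = A" using f by (simp add: f_def A_def B_def)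
    then show ?thesis by (metis add_self_left add.commute add.assoc)
  qed
  have "A\<^sup>2 * a\<^sup>2 + A * B + b\<^sup>2 = a\<^sup>2"
    using arg_cong[OF f, of \<sigma>] by (simp add: sigma_f A_def B_def)
  then have a2: "a\<^sup>2 = A\<^sup>2 + A * a * b + b\<^sup>2"
    by (simp add: B algebra_simps power2_eq_square)
  have s: "s = (a + a * A + b) / A"
    by (simp add: s_def A_def)
  have As: "A * s = a + a * A + b"
    using \<open>A \<noteq> 0\<close> by (simp add: s)
  have "S = (A + A * a\<^sup>2 + B) / a\<^sup>2"
    by (simp add: S_def s A_def B_def)
  then have S: "S = b / a"
    using \<open>a \<noteq> 0\<close> by (simp add: B field_simps power2_eq_square)
  then have aS: "a * S = b"
    using \<open>a \<noteq> 0\<close> by simp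
  have t: "t = s + a + s * S" by (simp add: t_def S_def)
  have "s\<^sup>2 = \<sigma> S" by (simp add: S_def)
  also have "\<dots> = B / A" by (simp add: S A_def B_def)
  finally have As2: "A * s\<^sup>2 = B" using \<open>A \<noteq> 0\<close> by simp
  have R: "R = S + A + S * s\<^sup>2" by (simp add: t R_def S_def A_def)
  have e: "(a + b) * s = a\<^sup>2 + A"
  proof -
    have "A * ((a + b) * s) = (a + b) * (A * s)" by (simp add: ac_simps)
    also have "\<dots> = A * a\<^sup>2 + (a\<^sup>2 + A * a * b + b\<^sup>2)"
      by (simp add: As algebra_simps power2_eq_square)
    also have "\<dots> = A * (a\<^sup>2 + A)"
      by (subst (2) a2) (simp add: algebra_simps power2_eq_square)
    finally show ?thesis using \<open>A \<noteq> 0\<close> by simp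
  qed
  have st: "s\<^sup>2 * S + s\<^sup>2 + a * s + S + A = 1"
  proof -
    have "A * a * (s\<^sup>2 * S + s\<^sup>2 + a * s + S + A) =
        (A * s\<^sup>2) * (a * S) + a * (A * s\<^sup>2) + a\<^sup>2 * (A * s) + A * (a * S) + A\<^sup>2 * a"
      by (simp add: algebra_simps power2_eq_square)
    also have "\<dots> = A * a + a * (a\<^sup>2 + (A\<^sup>2 + A * a * b + b\<^sup>2))"
      unfolding As2 aS As B by (simp add: algebra_simps power2_eq_square)
    also have "\<dots> = A * a" unfolding a2[symmetric] by simp
    finally show ?thesis using \<open>A \<noteq> 0\<close> \<open>a \<noteq> 0\<close> by simp
  qed
  have R1: "R = 1 + s\<^sup>2 + a * s"
    unfolding R st[symmetric] by (simp add: ac_simps)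
  have RS: "S * R = 1 + s\<^sup>2 + a\<^sup>2"
  proof -
    have "a\<^sup>2 * A * (S * R + (1 + s\<^sup>2 + a\<^sup>2)) =
        (a * S)\<^sup>2 * (A + A * s\<^sup>2) + a * A\<^sup>2 * (a * S) + a\<^sup>2 * (A + A * s\<^sup>2 + a\<^sup>2 * A)"
      unfolding R by (simp add: algebra_simps power2_eq_square)
    also have "\<dots> = a * b * (a\<^sup>2 + (A\<^sup>2 + A * a * b + b\<^sup>2))"
      unfolding As2 aS B by (simp add: algebra_simps power2_eq_square)
    also have "\<dots> = 0" unfolding a2[symmetric] by simp
    finally show ?thesis using \<open>A \<noteq> 0\<close> \<open>a \<noteq> 0\<close> by (simp add: add_eq_0)
  qed
  have tR: "t * R = a"
  proof -
    have "t * R = (s + a) * R + s * (S * R)"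
      by (simp add: t algebra_simps)
    then show ?thesis
      unfolding RS by (simp add: R1 algebra_simps power2_eq_square)
  qed
  have fst: "f s t = 1"
  proof -
    have "f s t = s\<^sup>2 * S + s * t + R"
      by (simp add: f_def S_def R_def)
    also have "\<dots> = s\<^sup>2 * S + s\<^sup>2 + a * s + S + A"
      by (simp add: t R algebra_simps power2_eq_square)
    finally show ?thesis unfolding st .
  qed
  have fts: "f t (s + a) = 1"
  proof -
    have "f t (s + a) = t * (t * R) + t * (s + a) + (S + A)"
      by (simp add: f_def S_def R_def A_def power2_eq_square)
    also have "\<dots> = s\<^sup>2 * S + s\<^sup>2 + a * s + S + A"
      unfolding tR by (simp add: t algebra_simps power2_eq_square)
    finally show ?thesis unfolding st .
  qed
  have Tst: "T s t = mat_of_rows_list 4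
     [[1, 0, 0, 0], [s, 1, 0, 0], [t, S, 1, 0], [1, s + a, s, 1]]"
    by (simp add: T_eq fst flip: S_def) (simp add: t)
  have Tts: "T t (s + a) = mat_of_rows_list 4
     [[1, 0, 0, 0], [t, 1, 0, 0], [s + a, R, 1, 0], [1, s, t, 1]]"
    using tR fts by (simp add: T_eq add_ac flip: R_def)
  have Tab: "T a b = mat_of_rows_list 4
     [[1, 0, 0, 0], [a, 1, 0, 0], [b, A, 1, 0], [A, a * A + b, a, 1]]"
    by (simp add: T_eq fA flip: A_def)
  have entries: "a + (s * A + (a * A + b)) = 0" "(s + a) * a + (s * b + A) = 0"
    "t * (s + a) + S = 1" "S + A = t * s + 1" "S * a + b = 0" "a + R * t = 0"
    "(s + a) * (s + a) + R * S + 1 = 0" "(s + a) * s + R = 1" "s + a + s * S + t = 0"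
  proof -
    show "a + (s * A + (a * A + b)) = 0"
      using As by (simp add: mult.commute add_ac)
    show "(s + a) * a + (s * b + A) = 0"
      using e by (simp add: algebra_simps power2_eq_square)
    have "t * (s + a) + S = s\<^sup>2 + a\<^sup>2 + s\<^sup>2 * S + s * (a * S) + S"
      by (simp add: t algebra_simps power2_eq_square)
    also have "\<dots> = (s\<^sup>2 * S + s\<^sup>2 + a * s + S + A) + ((a + b) * s + (a\<^sup>2 + A))"
      unfolding aS by (simp add: algebra_simps power2_eq_square)
    also have "\<dots> = 1"
      unfolding st e by simp
    finally show "t * (s + a) + S = 1" .
    have "S + A = t * s + (s\<^sup>2 * S + s\<^sup>2 + a * s + S + A)"
      by (simp add: t algebra_simps power2_eq_square)
    then show "S + A = t * s + 1"
      unfolding st .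
    show "S * a + b = 0" using aS by (simp add: mult.commute)
    show "a + R * t = 0" using tR by (simp add: mult.commute)
    show "(s + a) * (s + a) + R * S + 1 = 0"
      using RS by (simp add: algebra_simps power2_eq_square)
    show "(s + a) * s + R = 1"
      by (simp add: R1 algebra_simps power2_eq_square)
    show "s + a + s * S + t = 0"
      by (simp add: t)
  qed
  show ?thesis
    unfolding Tst Tts Tab sz_W_def mat4_mult
    by (rule arg_cong[where f = "mat_of_rows_list 4"]) (simp add: entries)
qed

section \<open>Bruhat decomposition\<close>

definition B :: "'a mat set" where
  "B = {D l * T a b | l a b. l \<noteq> 0}"

abbreviation G :: "'a mat monoid" where "G \<equiv> Suzuki n"

lemma carrier_G [simp]: "carrier G = sz_set n"
  and mult_G [simp]: "x \<otimes>\<^bsub>G\<^esub> y = x * y"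
  and one_G [simp]: "\<one>\<^bsub>G\<^esub> = 1\<^sub>m 4"
  by (simp_all add: Suzuki_def)

lemma T_carrier: "T a b \<in> carrier_mat 4 4" and D_carrier: "D l \<in> carrier_mat 4 4"
  and W_carrier: "W \<in> carrier_mat 4 4"
  by (auto simp: sz_T_def sz_D_def sz_W_def mat_of_rows_list_def)

lemma sz_gens_cases:
  assumes "g \<in> sz_gens n"
  obtains (T) a b where "g = T a b" | (D) l where "l \<noteq> 0" "g = D l" | (W) "g = W"
  using assms by (auto simp: sz_gens_def)

lemma sz_gens_carrier: "g \<in> sz_gens n \<Longrightarrow> g \<in> carrier_mat 4 4" for g :: "'a mat"
  by (auto elim!: sz_gens_cases simp: T_carrier D_carrier W_carrier)

lemma sz_set_carrier: "g \<in> sz_set n \<Longrightarrow> g \<in> carrier_mat 4 4" for g :: "'a mat"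
  by (induction rule: sz_set.induct) (auto intro: mult_carrier_mat sz_gens_carrier)

lemma assoc:
  "x \<in> sz_set n \<Longrightarrow> y \<in> sz_set n \<Longrightarrow> z \<in> sz_set n \<Longrightarrow> x * y * z = x * (y * z)"
  for x y z :: "'a mat"
  by (intro assoc_mult_mat[of _ 4 4 _ 4 _ 4] sz_set_carrier)

lemma sz_gens_in_sz_set: "g \<in> sz_gens n \<Longrightarrow> g \<in> sz_set n" for g :: "'a mat"
  using sz_set.step[OF _ sz_set.one, of g n] sz_gens_carrier[of g] by simp

lemma gens_closed [simp, intro]:
  "T a b \<in> sz_set n" "l \<noteq> 0 \<Longrightarrow> D l \<in> sz_set n" "W \<in> sz_set n"
  by (rule sz_gens_in_sz_set, unfold sz_gens_def, blast)+

lemma one_closed [simp, intro]: "1\<^sub>m 4 \<in> sz_set n"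
  by (rule sz_set.one)

lemma one_mult [simp]: "x \<in> sz_set n \<Longrightarrow> 1\<^sub>m 4 * x = x"
  and mult_one [simp]: "x \<in> sz_set n \<Longrightarrow> x * 1\<^sub>m 4 = x" for x :: "'a mat"
  by (auto intro: left_mult_one_mat right_mult_one_mat dest: sz_set_carrier)

lemma mult_closed [simp, intro]:
  fixes x y :: "'a mat"
  assumes "x \<in> sz_set n" "y \<in> sz_set n"
  shows "x * y \<in> sz_set n"
  using assms(1)
proof induction
  case one
  then show ?case using assms(2) by simp
next
  case (step g h)
  then show ?case
    using assms(2) by (simp add: assoc sz_gens_in_sz_set sz_set.step)
qed

lemma T_inverse: "T a (b + a * \<sigma> a) * T a b = 1\<^sub>m 4" "T a b * T a (b + a * \<sigma> a) = 1\<^sub>m 4"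
  by (simp_all add: T_mult T_0_0 mult.commute add_ac)

lemma D_inverse: "l \<noteq> 0 \<Longrightarrow> D (1 / l) * D l = 1\<^sub>m 4" "l \<noteq> 0 \<Longrightarrow> D l * D (1 / l) = 1\<^sub>m 4"
  by (simp_all add: D_mult D_1)

lemma group_G: "group G"
proof (rule groupI)
  fix x assume "x \<in> carrier G"
  then have "x \<in> sz_set n" by simp
  then show "\<exists>y\<in>carrier G. y \<otimes>\<^bsub>G\<^esub> x = \<one>\<^bsub>G\<^esub>"
  proof induction
    case one
    show ?case by (auto intro: bexI[of _ "1\<^sub>m 4"])
  next
    case (step g h)
    from step.IH obtain h' where h': "h' \<in> sz_set n" "h' * h = 1\<^sub>m 4" by auto
    from step.hyps(1) obtain g' where g': "g' \<in> sz_set n" "g' * g = 1\<^sub>m 4"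
    proof (cases rule: sz_gens_cases)
      case (T a b)
      then show ?thesis using that T_inverse(1) by blast
    next
      case (D l)
      then show ?thesis using that[of "D (1 / l)"] D_inverse(1) by simp
    next
      case W
      then show ?thesis using that W_mult_W by blast
    qed
    have g: "g \<in> sz_set n" using step.hyps(1) by (rule sz_gens_in_sz_set)
    have "(h' * g') * (g * h) = h' * ((g' * g) * h)"
      using g g'(1) h'(1) step.hyps(2) by (simp only: assoc mult_closed)
    also have "\<dots> = 1\<^sub>m 4"
      using g' h' step.hyps(2) by simp
    finally show ?case
      using g' h' by (auto intro!: bexI[of _ "h' * g'"])
  qed
qed (auto simp: assoc)

sublocale Sz: group G
  by (rule group_G)

lemma mult_left_rules:
  assumes "z \<in> sz_set n"
  shows "T a b * (T c d * z) = T (a + c) (b + d + \<sigma> a * c) * z"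
    and "l \<noteq> 0 \<Longrightarrow> m \<noteq> 0 \<Longrightarrow> D l * (D m * z) = D (l * m) * z"
    and "l \<noteq> 0 \<Longrightarrow> T a b * (D l * z) = D l * (T (a * l) (b * (l * \<sigma> l)) * z)"
    and "W * (W * z) = z"
    and "l \<noteq> 0 \<Longrightarrow> W * (D l * z) = D (1 / l) * (W * z)"
  using assms
  by (simp_all add: T_mult D_mult T_D W_mult_W W_D flip: assoc)

text \<open>Rewriting with these rules moves the diagonal factors to the left.\<close>

lemmas normal_form = assoc T_mult D_mult T_D W_mult_W W_D mult_left_rules

lemma bruhat_W:
  assumes "(a, b) \<noteq> (0, 0)"
  obtains m x y x' y' where "m \<noteq> 0" "W * (T a b * W) = D m * (T x y * (W * T x' y'))"
proof -
  define p c where "p = f a b" and "c = a * \<sigma> a + b"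
  define V where "V = T (c / p) (a / p + c / p * \<sigma> (c / p))"
  define m where "m = p\<^sup>2 / \<sigma> p"
  have "m \<noteq> 0" using assms by (simp add: m_def p_def)
  have "T (c / p) (a / p) * V = 1\<^sub>m 4"
    unfolding V_def by (rule T_inverse)
  then have "W * (T a b * W) = W * T a b * W * (T (c / p) (a / p) * V)"
    by (simp add: assoc)
  also have "\<dots> = (W * T a b * W * T (c / p) (a / p)) * V"
    by (simp add: V_def assoc)
  also have "\<dots> = T (b / p) (a / p) * D m * W * V"
    unfolding m_def p_def c_def by (simp only: bruhat_step[OF assms])
  also have "\<dots> = D m * (T (b / p * m) (a / p * (m * \<sigma> m)) * (W * V))"
    unfolding V_def using \<open>m \<noteq> 0\<close> by (simp add: normal_form)
  finally show thesis
    using that \<open>m \<noteq> 0\<close> unfolding V_def by blast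
qed

lemma bruhat_cases:
  assumes "x \<in> sz_set n"
  obtains (small) l a b where "l \<noteq> 0" "x = D l * T a b"
  | (big) l a b c d where "l \<noteq> 0" "x = D l * (T a b * (W * T c d))"
proof -
  have "(\<exists>l a b. l \<noteq> 0 \<and> x = D l * T a b) \<or> (\<exists>l a b c d. l \<noteq> 0 \<and> x = D l * (T a b * (W * T c d)))"
    using assms
  proof induction
    case one
    have "1\<^sub>m 4 = D 1 * T 0 0" by (simp add: D_1 T_0_0)
    then show ?case by (metis zero_neq_one)
  next
    case (step g h)
    have big: ?case if "l \<noteq> 0" "g * h = D l * (T a b * (W * T c d))" for l a b c d
      using that by blast
    have small: ?case if "l \<noteq> 0" "g * h = D l * T a b" for l a b
      using that by blast
    from step.IH show ?case
    proof (elim disjE exE conjE)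
      fix l a b assume l: "l \<noteq> 0" and h: "h = D l * T a b"
      from step.hyps(1) show ?case
      proof (cases rule: sz_gens_cases)
        case (T c d)
        then have "g * h = D l * T (c * l + a) (d * (l * \<sigma> l) + b + \<sigma> (c * l) * a)"
          using l h by (simp add: normal_form)
        with l show ?thesis by (rule small)
      next
        case (D m)
        then show ?thesis using l h by (intro small[of "m * l"]) (auto simp: normal_form)
      next
        case W
        have "g * h = D (1 / l) * (T 0 0 * (W * T a b))"
          using W l h by (simp add: normal_form T_0_0)
        then show ?thesis using l by (intro big[of "1 / l"]) auto
      qed
    next
      fix l a b c d assume l: "l \<noteq> 0" and h: "h = D l * (T a b * (W * T c d))"
      from step.hyps(1) show ?case
      proof (cases rule: sz_gens_cases)
        case (T u v)
        then have "g * h = D l * (T (u * l + a) (v * (l * \<sigma> l) + b + \<sigma> (u * l) * a) * (W * T c d))"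
          using l h by (simp add: normal_form)
        with l show ?thesis by (rule big)
      next
        case (D m)
        then show ?thesis using l h by (intro big[of "m * l"]) (auto simp: normal_form)
      next
        case W
        show ?thesis
        proof (cases "(a, b) = (0, 0)")
          case True
          then have "g * h = D (1 / l) * T c d"
            using W l h by (simp add: normal_form T_0_0)
          then show ?thesis using l by (intro small[of "1 / l"]) auto
        next
          case False
          then obtain m x y x' y' where m: "m \<noteq> 0"
              "W * (T a b * W) = D m * (T x y * (W * T x' y'))"
            by (rule bruhat_W)
          have "g * h = D (1 / l) * ((W * (T a b * W)) * T c d)"
            using W l h by (simp add: normal_form)
          also have "\<dots> = D (1 / l * m) * (T x y * (W * T (x' + c) (y' + d + \<sigma> x' * c)))"
            unfolding m(2) using m(1) l by (simp add: normal_form)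
          finally show ?thesis
            using m(1) l by (intro big[of "1 / l * m"]) auto
        qed
      qed
    qed
  qed
  then show thesis using small big by blast
qed

lemma mat_of_rows_list_entries:
  "mat_of_rows_list 4 [[a11,a12,a13,a14],r2,r3,r4] $$ (0, 0) = a11"
  "mat_of_rows_list 4 [[a11,a12,a13,a14],r2,r3,r4] $$ (0, 3) = a14"
  by (simp_all add: mat_of_rows_list_def)

lemma corner_small: "(D l * T a b) $$ (0, 3) = 0"
  by (simp add: mat_simps D_eq mat_of_rows_list_entries)

lemma corner_W_T_W: "(W * (T a b * W)) $$ (0, 3) = f a b"
  by (simp add: mat_simps mat_of_rows_list_entries)

lemma corner_W_T: "(W * T a b) $$ (0, 3) = 1"
  by (simp add: mat_simps mat_of_rows_list_entries)

lemma inv_T: "inv\<^bsub>G\<^esub> (T a b) = T a (b + a * \<sigma> a)"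
  by (rule Sz.inv_equality) (simp_all add: T_inverse)

lemma inv_D: "l \<noteq> 0 \<Longrightarrow> inv\<^bsub>G\<^esub> (D l) = D (1 / l)"
  by (rule Sz.inv_equality) (simp_all add: D_inverse)

lemma B_intro: "l \<noteq> 0 \<Longrightarrow> D l * T a b \<in> B"
  by (auto simp: B_def)

lemma subgroup_B: "subgroup B G"
proof (rule Sz.subgroupI)
  show "B \<subseteq> carrier G" by (auto simp: B_def)
  show "B \<noteq> {}" using B_intro[of 1 0 0] by auto
next
  fix x assume "x \<in> B"
  then obtain l a b where l: "l \<noteq> 0" "x = D l * T a b" by (auto simp: B_def)
  have "inv\<^bsub>G\<^esub> x = T a (b + a * \<sigma> a) * D (1 / l)"
    using l Sz.inv_mult_group[of "D l" "T a b"] by (simp add: inv_T inv_D)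
  then show "inv\<^bsub>G\<^esub> x \<in> B"
    using l by (simp add: normal_form B_intro)
next
  fix x y assume "x \<in> B" "y \<in> B"
  then obtain l a b m c d where "l \<noteq> 0" "x = D l * T a b" "m \<noteq> 0" "y = D m * T c d"
    by (auto simp: B_def)
  then show "x \<otimes>\<^bsub>G\<^esub> y \<in> B"
    by (simp add: normal_form B_intro)
qed

lemma rcosets_B:
  "rcosets\<^bsub>G\<^esub> B = insert B ((\<lambda>(a, b). B #>\<^bsub>G\<^esub> (W * T a b)) ` UNIV)"
proof
  have BG: "B \<subseteq> carrier G" using subgroup_B by (rule subgroup.subset)
  show "rcosets\<^bsub>G\<^esub> B \<subseteq> insert B ((\<lambda>(a, b). B #>\<^bsub>G\<^esub> (W * T a b)) ` UNIV)"
  proof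
    fix K assume "K \<in> rcosets\<^bsub>G\<^esub> B"
    then obtain x where x: "x \<in> sz_set n" "K = B #>\<^bsub>G\<^esub> x" by (auto simp: RCOSETS_def)
    from x(1) show "K \<in> insert B ((\<lambda>(a, b). B #>\<^bsub>G\<^esub> (W * T a b)) ` UNIV)"
    proof (cases rule: bruhat_cases)
      case (small l a b)
      then have "x \<in> B" by (simp add: B_intro)
      then show ?thesis
        using x Sz.coset_join2[OF _ subgroup_B] by auto
    next
      case (big l a b c d)
      then have "x = D l * T a b * (W * T c d)" by (simp add: assoc)
      then have "K = (B #>\<^bsub>G\<^esub> (D l * T a b)) #>\<^bsub>G\<^esub> (W * T c d)"
        using x big BG by (simp add: Sz.coset_mult_assoc)
      also have "B #>\<^bsub>G\<^esub> (D l * T a b) = B"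
        using big Sz.coset_join2[OF _ subgroup_B, of "D l * T a b"] B_intro by auto
      finally show ?thesis by auto
    qed
  qed
  show "insert B ((\<lambda>(a, b). B #>\<^bsub>G\<^esub> (W * T a b)) ` UNIV) \<subseteq> rcosets\<^bsub>G\<^esub> B"
    using Sz.rcosetsI[OF BG] Sz.coset_mult_one[OF BG] Sz.rcosetsI[OF BG Sz.one_closed] by auto
qed

lemma odd_card_rcosets_B: "odd (card (rcosets\<^bsub>G\<^esub> B))"
proof -
  let ?K = "\<lambda>(a, b). B #>\<^bsub>G\<^esub> (W * T a b)"
  have self: "W * T a b \<in> B #>\<^bsub>G\<^esub> (W * T a b)" for a b
    using Sz.rcos_self[OF _ subgroup_B, of "W * T a b"] by simp
  have "B \<notin> range ?K"
  proof
    assume "B \<in> range ?K"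
    then obtain a b where "B = B #>\<^bsub>G\<^esub> (W * T a b)" by auto
    then have "W * T a b \<in> B" using self by metis
    then obtain l c d where "W * T a b = D l * T c d" by (auto simp: B_def)
    then show False
      using corner_W_T[of a b] corner_small[of l c d] by simp
  qed
  moreover have "inj ?K"
  proof (rule injI, clarify)
    fix a b c d
    assume "B #>\<^bsub>G\<^esub> (W * T a b) = B #>\<^bsub>G\<^esub> (W * T c d)"
    then have "W * T a b \<in> B #>\<^bsub>G\<^esub> (W * T c d)" using self by metis
    then obtain l x y where l: "l \<noteq> 0" "W * T a b = D l * T x y * (W * T c d)"
      by (auto simp: r_coset_def B_def)
    define q where "q = b + (d + c * \<sigma> c) + \<sigma> a * c"
    have T: "T a b * T c (d + c * \<sigma> c) = T (a + c) q"
      by (simp add: T_mult q_def)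
    have "W * (T (a + c) q * W) = W * T a b * (T c (d + c * \<sigma> c) * W)"
      by (simp add: assoc flip: T)
    also have "\<dots> = D l * (T x y * (W * ((T c d * T c (d + c * \<sigma> c)) * W)))"
      unfolding l(2) using l(1) by (simp add: assoc)
    also have "\<dots> = D l * T x y"
      using l(1) by (simp add: T_inverse W_mult_W)
    finally have "f (a + c) q = 0"
      using corner_W_T_W corner_small by metis
    then show "a = c \<and> b = d"
      by (auto simp: q_def add_eq_0 mult.commute add_ac)
  qed
  then have "card (range ?K) = 2 ^ (2 * n + 1) * 2 ^ (2 * n + 1)"
    by (simp add: card_image card_field flip: UNIV_Times_UNIV)
  ultimately show ?thesis
    by (simp add: rcosets_B)
qed

section \<open>Classes of elements of order four\<close>

lemma T_square: "T a b * T a b = T 0 (\<sigma> a * a)"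
  by (simp add: T_mult)

lemma order_4_conjugate_T:
  assumes x: "x \<in> sz_set n" and ord: "Sz.ord x = 4"
  obtains g u where "g \<in> sz_set n" "Sz.conjugate g x = T 1 u"
proof -
  have "finite (rcosets\<^bsub>G\<^esub> B)"
    using odd_card_rcosets_B by (metis card.infinite even_zero)
  moreover have "x [^]\<^bsub>G\<^esub> (2 ^ 2 :: nat) = \<one>\<^bsub>G\<^esub>"
    using x ord Sz.pow_eq_id[of x 4] by simp
  ultimately obtain g where g: "g \<in> sz_set n" "Sz.conjugate g x \<in> B"
    using Sz.two_element_conjugate_in_odd_index_subgroup[OF subgroup_B _ odd_card_rcosets_B, of x 2] x
    by auto
  then obtain l a b where l: "l \<noteq> 0" and y: "Sz.conjugate g x = D l * T a b"
    by (auto simp: B_def)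
  define y where "y = D l * T a b"
  have ord_y: "Sz.ord y = 4"
    using ord x g(1) Sz.ord_conjugate[of g x] by (simp add: y_def flip: y)
  have [simp]: "y \<in> sz_set n" using l by (simp add: y_def)
  have four: "(4::nat) = Suc (Suc (Suc (Suc 0)))" by simp
  have "y [^]\<^bsub>G\<^esub> (4::nat) = y * (y * (y * y))"
    by (subst four) (simp add: assoc)
  then have "y * (y * (y * y)) = 1\<^sub>m 4"
    using Sz.pow_eq_id[of y 4] ord_y by simp
  moreover have "\<exists>c d. y * (y * (y * y)) = D (l ^ 4) * T c d"
    using l by (simp add: y_def normal_form power4_eq_xxxx mult.assoc) blast
  ultimately obtain c d where "D (l ^ 4) * T c d = 1\<^sub>m 4" by metis
  then have "(D (l ^ 4) * T c d) $$ (0, 0) = 1" by simp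
  then have "l ^ 4 * (l ^ 4) ^ 2 ^ n = 1"
    by (simp add: mat_simps D_eq mat_of_rows_list_entries)
  then have "(l * l ^ 2 ^ n) ^ 4 = 1"
    by (simp add: power_mult_distrib mult.commute flip: power_mult)
  then have "((l * l ^ 2 ^ n)\<^sup>2)\<^sup>2 = (1\<^sup>2)\<^sup>2"
    by (simp flip: power_mult)
  then have l1: "l * l ^ 2 ^ n = 1"
    by (simp only: square_eq_iff)
  have "l = 1"
  proof -
    have "(l * l ^ 2 ^ n)\<^sup>2 = 1" using l1 by simp
    then have s: "l\<^sup>2 * \<sigma> l = 1" by (simp add: power_mult_distrib half_sigma_square)
    then have "\<sigma> (l\<^sup>2 * \<sigma> l) = 1" by simp
    then have "\<sigma> l * (l\<^sup>2 * \<sigma> l) = 1" by (simp add: power2_eq_square ac_simps)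
    then have "l\<^sup>2 = 1\<^sup>2" using s by simp
    then show ?thesis by (simp only: square_eq_iff)
  qed
  then have y_T: "y = T a b" by (simp add: y_def D_1)
  have "a \<noteq> 0"
  proof
    assume "a = 0"
    then have "y * y = 1\<^sub>m 4" by (simp add: y_T T_square T_0_0)
    then have "y [^]\<^bsub>G\<^esub> (2::nat) = \<one>\<^bsub>G\<^esub>"
      by (subst numeral_2_eq_2) simp
    then show False using Sz.pow_eq_id[of y 2] ord_y by simp
  qed
  define u where "u = b / (a * \<sigma> a)"
  have "D a * T a b = T 1 u * D a"
    using \<open>a \<noteq> 0\<close> by (simp add: T_D u_def)
  then have "Sz.conjugate (D a) y = T 1 u"
    using \<open>a \<noteq> 0\<close> by (intro Sz.conjugate_eqI) (simp_all add: y_T)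
  then have "Sz.conjugate (D a * g) x = T 1 u"
    using g x \<open>a \<noteq> 0\<close> y Sz.conjugate_conjugate[of "D a" g x] by (simp add: y_def)
  then show thesis
    using that[of "D a * g" u] g \<open>a \<noteq> 0\<close> by simp
qed

abbreviation cls :: "'a \<Rightarrow> 'a mat set" where "cls u \<equiv> conj_class G (T 1 u)"

lemma conjugate_in_cls: "g \<in> sz_set n \<Longrightarrow> y \<in> cls u \<Longrightarrow> Sz.conjugate g y \<in> cls u"
  using Sz.conjugate_in_conj_class[of g "T 1 u" y] by simp

lemma T_1_in_cls: "T 1 u \<in> cls u"
  using Sz.self_in_conj_class[of "T 1 u"] by simp

lemma T_in_cls:
  assumes "e \<noteq> 0"
  shows "T e (e * \<sigma> e * u) \<in> cls u"
proof -
  have "D e * T e (e * \<sigma> e * u) = T 1 u * D e"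
    using assms by (simp add: T_D ac_simps)
  then have "Sz.conjugate (D e) (T e (e * \<sigma> e * u)) = T 1 u"
    using assms by (intro Sz.conjugate_eqI) simp_all
  then have "T e (e * \<sigma> e * u) = Sz.conjugate (inv\<^bsub>G\<^esub> (D e)) (T 1 u)"
    using assms Sz.conjugate_inv_conjugate[of "D e" "T e (e * \<sigma> e * u)"] by simp
  then show ?thesis
    using assms by (simp add: conjugate_in_cls T_1_in_cls inv_D)
qed

lemma linked_T:
  assumes "T a b \<in> cls u" "T c d \<in> cls u" "a \<noteq> 0"
  shows "Sz.linked (T 1 u) (T a b) (T c d)"
proof (cases "T a b = T c d")
  case False
  have "killing_adj G (cls u) (T a b) (T c d)"
  proof (cases "a + c = 0")
    case True
    then show ?thesis
      by (intro Sz.killing_adjI[where c = "T a b"]) (use assms False in \<open>simp_all add: T_mult add_ac\<close>)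
  next
    case e: False
    then show ?thesis
      by (intro Sz.killing_adjI[where c = "T (a + c) ((a + c) * \<sigma> (a + c) * u)"])
        (use assms False T_in_cls[OF e] in \<open>simp_all add: T_mult add_ac\<close>)
  qed
  then show ?thesis by blast
qed simp

lemma linked_W: "Sz.linked (T 1 u) (T 1 u) (Sz.conjugate W (T 1 u))"
proof -
  obtain a where a: "a\<^sup>2 = 1 / (1 + u + \<sigma> u)"
    using square_root by blast
  have u: "1 + u + \<sigma> u \<noteq> 0"
    by (metis sigma_neq_add_1 add_eq_0 add.assoc)
  then have "a \<noteq> 0" using a by auto
  define b where "b = a * \<sigma> a * u"
  have f: "f a b = \<sigma> a"
    using u a by (simp add: b_def f_scaled)
  have y: "T a b \<in> cls u"
    using T_in_cls[OF \<open>a \<noteq> 0\<close>] by (simp add: b_def)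
  have WyW: "Sz.conjugate W (T a b) = W * (T a b * W)"
    by (rule Sz.conjugate_eqI) (simp_all add: normal_form)
  obtain s t z where h: "W * T s t * (T a b * W) = T t z * (W * T s t)"
    using W_fixed_line[OF f \<open>a \<noteq> 0\<close>] by blast
  define k where "k = W * T s t"
  have [simp]: "k \<in> sz_set n" by (simp add: k_def)
  define v where "v = Sz.conjugate (inv\<^bsub>G\<^esub> k) (T 1 u)"
  have v: "v \<in> cls u"
    unfolding v_def by (rule conjugate_in_cls) (use Sz.inv_closed[of k] in \<open>simp_all add: T_1_in_cls\<close>)
  have v_closed: "v \<in> sz_set n"
    using v Sz.conj_class_subset[of "T 1 u"] by auto
  have kv: "k * v = T 1 u * k"
    using Sz.mult_conjugate_inv[of k "T 1 u"] by (simp add: v_def)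
  define M where "M = T a b * (W * (T a b * W))"
  have [simp]: "M \<in> sz_set n" by (simp add: M_def)
  have h': "k * (T a b * W) = T t z * k" using h by (simp add: k_def)
  have kM: "k * M = T 0 (\<sigma> t * t) * k"
  proof -
    have "k * M = (k * (T a b * W)) * (T a b * W)"
      by (simp add: M_def assoc)
    also have "\<dots> = T t z * (k * (T a b * W))"
      by (subst h') (simp add: assoc)
    also have "\<dots> = T 0 (\<sigma> t * t) * k"
      unfolding h' by (simp add: T_square flip: assoc)
    finally show ?thesis .
  qed
  have "k * (v * M) = T 1 u * (k * M)"
    using kv v_closed by (simp flip: assoc)
  also have "\<dots> = T 0 (\<sigma> t * t) * (T 1 u * k)"
    unfolding kM by (simp add: T_mult mult_left_rules add_ac)
  also have "\<dots> = k * (M * v)"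
    unfolding kv[symmetric] using kM v_closed by (simp flip: assoc)
  finally have "v * M = M * v"
    using v_closed Sz.Units_l_cancel[of k "v * M" "M * v"] Sz.Units_eq by simp
  moreover have "T a b \<noteq> W * (T a b * W)"
  proof
    assume "T a b = W * (T a b * W)"
    then have "f a b = T a b $$ (0, 3)" using corner_W_T_W[of a b] by simp
    then show False using \<open>a \<noteq> 0\<close> by (simp add: T_eq mat_of_rows_list_entries)
  qed
  moreover have "W * (T a b * W) \<in> cls u"
    using conjugate_in_cls[OF _ y, of W] by (simp add: WyW)
  ultimately have "killing_adj G (cls u) (T a b) (W * (T a b * W))"
    using y v v_closed by (intro Sz.killing_adjI[where c = v]) (simp_all add: M_def)
  then have "Sz.linked (T 1 u) (T a b) (Sz.conjugate W (T a b))"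
    by (auto simp: WyW)
  moreover have "Sz.linked (T 1 u) (T 1 u) (T a b)"
    by (rule linked_T) (use T_1_in_cls y in auto)
  moreover have "Sz.linked (T 1 u) (Sz.conjugate W (T a b)) (Sz.conjugate W (T 1 u))"
    by (rule Sz.linked_conjugate) (use T_1_in_cls y \<open>a \<noteq> 0\<close> in \<open>auto intro: linked_T\<close>)
  ultimately show ?thesis by (meson rtrancl_trans)
qed

lemma linked_gens:
  assumes "g \<in> sz_gens n"
  shows "Sz.linked (T 1 u) (T 1 u) (Sz.conjugate g (T 1 u))"
  using assms
proof (cases rule: sz_gens_cases)
  case (T a b)
  have "Sz.conjugate (T a b) (T 1 u) = T 1 (u + \<sigma> a + a)"
    by (rule Sz.conjugate_eqI) (simp_all add: T_mult add_ac)
  then show ?thesis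
    using T linked_T[OF T_1_in_cls, of 1] conjugate_in_cls[OF _ T_1_in_cls, of "T a b" u] by simp
next
  case (D l)
  define e where "e = 1 / l"
  have "e \<noteq> 0" using D by (simp add: e_def)
  have "D l * T 1 u = T e (e * \<sigma> e * u) * D l"
    using D by (simp add: T_D e_def)
  then have "Sz.conjugate (D l) (T 1 u) = T e (e * \<sigma> e * u)"
    using D by (intro Sz.conjugate_eqI) simp_all
  then show ?thesis
    using D linked_T[OF T_1_in_cls T_in_cls[OF \<open>e \<noteq> 0\<close>]] by simp
next
  case W
  then show ?thesis using linked_W by simp
qed

lemma killing_irreducible_cls: "killing_irreducible G (cls u)"
proof (rule Sz.killing_irreducibleI)
  fix g assume "g \<in> carrier G"
  then have "g \<in> sz_set n" by simp
  then show "Sz.linked (T 1 u) (T 1 u) (Sz.conjugate g (T 1 u))"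
  proof induction
    case one
    show ?case using Sz.conjugate_one[of "T 1 u"] by simp
  next
    case (step g h)
    then show ?case
      using Sz.linked_mult[of g h "T 1 u"] linked_gens sz_gens_in_sz_set by simp
  qed
qed simp

end

theorem theorem5p3:
  fixes n :: nat and x :: "'a::{field, finite} mat"
  assumes "n \<ge> 1"
    and "card (UNIV :: 'a set) = 2 ^ (2 * n + 1)"
    and "x \<in> carrier (Suzuki n)"
    and "group.ord (Suzuki n) x = 4"
  shows "killing_irreducible (Suzuki n) (conj_class (Suzuki n) x)"
proof -
  interpret suzuki_field n "TYPE('a)"
    by standard (rule assms(2))
  obtain g u where g: "g \<in> carrier (Suzuki n)" "Sz.conjugate g x = T 1 u"
    using order_4_conjugate_T assms(3,4) by auto
  then have "conj_class (Suzuki n) x = cls u"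
    using Sz.conj_class_conjugate[OF g(1) assms(3)] by simp
  then show ?thesis
    using killing_irreducible_cls by simp
qed

end
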